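(* $P(6,3)\leq 116$, $P(7,3)\leq 716$, $P(11,3)\leq 10!-10$, $P(13,3)\leq 12!-12$, and $P(17,3)\leq 16!-5$.
   Context: $S_n$ denotes the set of all permutations of $[n]=\{1,\dots,n\}$. The Kendall $\tau$-distance $d_K(\rho,\pi)$ between $\rho,\pi\in S_n$ is the minimum number of adjacent transpositions $(i,i+1)$ ($1\leq i\leq n-1$) whose product equals $\rho\pi^{-1}$. $P(n,d)$ denotes the maximum size of a subset $C\subseteq S_n$ such that $d_K(x,y)\geq d$ for all distinct $x,y\in C$. *)

theory Defs
  imports "HOL-Combinatorics.Permutations"
begin

definition Sym :: "nat \<Rightarrow> (nat \<Rightarrow> nat) set" where
  "Sym n = {p. p permutes {1..n}}"

definition adj_prod :: "nat list \<Rightarrow> (nat \<Rightarrow> nat)" where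
  "adj_prod ts = foldr (\<lambda>i f. transpose i (Suc i) \<circ> f) ts id"

definition kendall_dist :: "nat \<Rightarrow> (nat \<Rightarrow> nat) \<Rightarrow> (nat \<Rightarrow> nat) \<Rightarrow> nat" where
  "kendall_dist n \<rho> \<pi> = (LEAST k. \<exists>ts. length ts = k \<and> (\<forall>i\<in>set ts. 1 \<le> i \<and> i \<le> n - 1)
       \<and> adj_prod ts = \<rho> \<circ> inv \<pi>)"

definition P :: "nat \<Rightarrow> nat \<Rightarrow> nat" where
  "P n d = Max {card C | C. C \<subseteq> Sym n \<and>
      (\<forall>x\<in>C. \<forall>y\<in>C. x \<noteq> y \<longrightarrow> kendall_dist n x y \<ge> d)}"

end

theory Submission
  imports Defs
begin

text \<open>
  The unit balls around the words of a code are disjoint, so the task is to show that they miss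
  many permutations.

  For \<open>n \<ge> 9\<close> with \<open>(n - 2)! \<equiv> 1 (mod n)\<close>, which holds for every prime, count the code words \<open>c\<close>
  with \<open>(c 1, c 2) = v\<close> for each ordered pair \<open>v\<close>. Writing \<open>(n - 2)! = n q + 1\<close>, the excess \<open>z v\<close>
  of this number over \<open>q\<close> satisfies \<open>(\<Sum>k<n. z (s\<^sub>k v)) \<le> 1\<close>, where \<open>s\<^sub>0\<close> is the identity. Since at
  most four of the \<open>s\<^sub>k\<close> move \<open>v\<close>, a positive excess at \<open>v\<close> forces a much larger negative excess at
  the neighbours of \<open>v\<close>, hence \<open>\<Sum>z \<le> 0\<close> and the code has at most \<open>(n - 1)! - (n - 1)\<close> words.

  For \<open>n = 6\<close> and \<open>n = 7\<close> there is a local obstruction: a set \<open>R\<close> of 72 permutations, namely the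
  unit neighbourhood of a Young subgroup, in which every code leaves at least two (for \<open>n = 6\<close>) or
  one (for \<open>n = 7\<close>) permutations uncovered. Averaging over the right translates of \<open>R\<close> bounds the
  total number of uncovered permutations from below.
\<close>

section \<open>Unit balls\<close>

text \<open>Index 0 stands for the identity, so the unit ball around \<open>c\<close>, centre
  included, consists of the \<open>gen k \<circ> c\<close> with \<open>k < n\<close>.\<close>

definition gen :: "nat \<Rightarrow> nat \<Rightarrow> nat" where
  "gen k = (if k = 0 then id else transpose k (Suc k))"

lemma gen_apply:
  "gen k x = (if k = 0 then x else if x = k then Suc k else if x = Suc k then k else x)"
  by (auto simp: gen_def transpose_def)

lemma gen_gen [simp]: "gen k (gen k x) = x"
  by (simp add: gen_def)

lemma gen_comp_gen [simp]: "gen k \<circ> gen k = id"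
  by (simp add: fun_eq_iff)

lemma inj_gen: "inj gen"
proof (rule injI)
  fix k l assume eq: "gen k = gen l"
  have "gen k k = gen l k" "gen k l = gen l l"
    using eq by simp_all
  then show "k = l"
    by (auto simp: gen_apply split: if_splits)
qed

lemma gen_permutes: "k < n \<Longrightarrow> gen k permutes {1..n}"
  using permutes_swap_id[of k "{1..n}" "Suc k"] by (cases "k = 0") (auto simp: gen_def)

lemma bij_Sym: "p \<in> Sym n \<Longrightarrow> bij p"
  by (simp add: Sym_def permutes_bij)

lemma comp_Sym: "p \<in> Sym n \<Longrightarrow> q \<in> Sym n \<Longrightarrow> p \<circ> q \<in> Sym n"
  by (simp add: Sym_def permutes_compose)

lemma inv_Sym: "p \<in> Sym n \<Longrightarrow> inv p \<in> Sym n"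
  by (simp add: Sym_def permutes_inv)

lemma gen_Sym: "k < n \<Longrightarrow> gen k \<in> Sym n"
  unfolding Sym_def using gen_permutes by blast

lemma finite_Sym [simp]: "finite (Sym n)"
  by (simp add: Sym_def finite_permutations)

lemma card_Sym: "card (Sym n) = fact n"
  by (simp add: Sym_def card_permutations)

lemma comp_right_cancel_Sym: "g \<in> Sym n \<Longrightarrow> p \<circ> g = q \<circ> g \<Longrightarrow> p = q"
  using bij_Sym[of g n] by (metis bij_is_surj surj_fun_eq)

lemma comp_left_cancel_Sym: "g \<in> Sym n \<Longrightarrow> g \<circ> p = g \<circ> q \<Longrightarrow> p = q"
  using bij_Sym[of g n] by (metis bij_is_inj injD fun_eq_iff comp_apply)

text \<open>Disjointness of the unit balls, the form in which minimum distance 3 enters all counting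
  arguments.\<close>

definition packing :: "nat \<Rightarrow> (nat \<Rightarrow> nat) set \<Rightarrow> bool" where
  "packing n C \<longleftrightarrow> C \<subseteq> Sym n \<and>
     (\<forall>x\<in>C. \<forall>y\<in>C. \<forall>k<n. \<forall>l<n. gen k \<circ> x = gen l \<circ> y \<longrightarrow> x = y)"

lemma packingD:
  "packing n C \<Longrightarrow> x \<in> C \<Longrightarrow> y \<in> C \<Longrightarrow> k < n \<Longrightarrow> l < n \<Longrightarrow> gen k \<circ> x = gen l \<circ> y \<Longrightarrow> x = y"
  by (auto simp: packing_def)

lemma packing_subset_Sym: "packing n C \<Longrightarrow> C \<subseteq> Sym n"
  by (simp add: packing_def)

lemma packing_finite: "packing n C \<Longrightarrow> finite C"
  by (rule finite_subset[OF packing_subset_Sym finite_Sym])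

text \<open>If the balls around \<open>x\<close> and \<open>y\<close> meet, then
  \<open>x \<circ> inv y = gen k \<circ> gen l\<close> is a product of at most two adjacent
  transpositions, so the distance is at most 2.\<close>

lemma packing_if_dist3:
  assumes C: "C \<subseteq> Sym n"
    and dist: "\<And>x y. x \<in> C \<Longrightarrow> y \<in> C \<Longrightarrow> x \<noteq> y \<Longrightarrow> kendall_dist n x y \<ge> 3"
  shows "packing n C"
  unfolding packing_def
proof (intro conjI ballI allI impI C)
  fix x y k l assume xy: "x \<in> C" "y \<in> C" and kl: "k < n" "l < n" and eq: "gen k \<circ> x = gen l \<circ> y"
  have y: "y \<circ> inv y = id"
    using bij_Sym[of y n] xy C by (auto simp: surj_iff[symmetric] bij_is_surj)
  have "gen k \<circ> (gen k \<circ> x) \<circ> inv y = gen k \<circ> (gen l \<circ> y) \<circ> inv y"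
    using eq by simp
  then have "x \<circ> inv y = gen k \<circ> gen l"
    using y by (simp add: comp_assoc) (simp add: comp_assoc[symmetric])
  \<comment> \<open>Index 0 is dropped because \<open>adj_prod\<close> would read it as the
    transposition of 0 and 1, whereas \<open>gen 0\<close> is the identity.\<close>
  moreover have "adj_prod (filter (\<lambda>i. i \<noteq> 0) [k, l]) = gen k \<circ> gen l"
    by (auto simp: adj_prod_def gen_def)
  ultimately have "\<exists>ts. length ts = length (filter (\<lambda>i. i \<noteq> 0) [k, l]) \<and>
      (\<forall>i\<in>set ts. 1 \<le> i \<and> i \<le> n - 1) \<and> adj_prod ts = x \<circ> inv y"
    using kl by (intro exI[of _ "filter (\<lambda>i. i \<noteq> 0) [k, l]"]) auto
  then have "kendall_dist n x y \<le> length (filter (\<lambda>i. i \<noteq> 0) [k, l])"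
    unfolding kendall_dist_def by (rule Least_le)
  also have "\<dots> \<le> 2"
    using length_filter_le[of "\<lambda>i. i \<noteq> 0" "[k, l]"] by simp
  finally show "x = y"
    using dist xy by fastforce
qed

lemma P_3_le:
  assumes "\<And>C. packing n C \<Longrightarrow> card C \<le> b"
  shows "P n 3 \<le> b"
proof -
  let ?A = "{card C | C. C \<subseteq> Sym n \<and> (\<forall>x\<in>C. \<forall>y\<in>C. x \<noteq> y \<longrightarrow> kendall_dist n x y \<ge> 3)}"
  have "?A \<subseteq> card ` Pow (Sym n)"
    by auto
  then have "finite ?A"
    by (rule finite_subset) simp
  moreover have "?A \<noteq> {}"
    by blast
  moreover have "a \<le> b" if "a \<in> ?A" for a
    using that assms packing_if_dist3 by blast
  ultimately show ?thesis
    unfolding P_def by (rule Max.boundedI)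
qed

lemma packing_ball_inj:
  assumes "packing n C"
  shows "inj_on (\<lambda>(k, c). gen k \<circ> c) ({..<n} \<times> C)"
proof (rule inj_onI)
  fix x y assume xy: "x \<in> {..<n} \<times> C" "y \<in> {..<n} \<times> C"
    and eq: "(case x of (k, c) \<Rightarrow> gen k \<circ> c) = (case y of (k, c) \<Rightarrow> gen k \<circ> c)"
  obtain k c l d where kc: "x = (k, c)" and ld: "y = (l, d)"
    by fastforce
  from xy eq have *: "k < n" "c \<in> C" "l < n" "d \<in> C" "gen k \<circ> c = gen l \<circ> d"
    by (simp_all add: kc ld)
  then have "c = d"
    using packingD[OF assms] by blast
  with * have "gen k = gen l"
    using comp_right_cancel_Sym packing_subset_Sym[OF assms] by blast
  then show "x = y"
    using \<open>c = d\<close> inj_gen by (auto simp: kc ld dest: injD)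
qed

text \<open>As \<open>gen k\<close> is an involution, \<open>gen k \<circ> p \<in> C\<close> for
  some \<open>k < n\<close> says that \<open>p\<close> lies in the ball around a code word.\<close>

definition uncovered :: "nat \<Rightarrow> (nat \<Rightarrow> nat) set \<Rightarrow> (nat \<Rightarrow> nat) set" where
  "uncovered n C = {p \<in> Sym n. \<forall>k<n. gen k \<circ> p \<notin> C}"

lemma card_packing:
  assumes C: "packing n C"
  shows "n * card C + card (uncovered n C) = fact n"
proof -
  let ?B = "(\<lambda>(k, c). gen k \<circ> c) ` ({..<n} \<times> C)"
  have B: "?B \<subseteq> Sym n"
    using packing_subset_Sym[OF C] by (auto intro!: comp_Sym gen_Sym)
  have "uncovered n C = Sym n - ?B"
  proof (intro set_eqI iffI)
    fix p assume p: "p \<in> uncovered n C"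
    have "p \<noteq> gen k \<circ> c" if "k < n" "c \<in> C" for k c
      using p that by (auto simp: uncovered_def comp_assoc[symmetric])
    then show "p \<in> Sym n - ?B"
      using p by (auto simp: uncovered_def)
  next
    fix p assume p: "p \<in> Sym n - ?B"
    have "gen k \<circ> p \<notin> C" if "k < n" for k
    proof
      assume "gen k \<circ> p \<in> C"
      then have "gen k \<circ> (gen k \<circ> p) \<in> ?B"
        using that by force
      then show False
        using p by (simp add: comp_assoc[symmetric])
    qed
    then show "p \<in> uncovered n C"
      using p by (simp add: uncovered_def)
  qed
  moreover have "card ?B = n * card C"
    using card_image[OF packing_ball_inj[OF C]] by (simp add: card_cartesian_product)
  ultimately show ?thesis
    using B card_Sym[of n] card_mono[OF finite_Sym B]
    by (simp add: card_Diff_subset finite_subset[OF B])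
qed

section \<open>The excess on ordered pairs\<close>

definition dpairs :: "nat \<Rightarrow> (nat \<times> nat) set" where
  "dpairs n = {(i, j). i \<in> {1..n} \<and> j \<in> {1..n} \<and> i \<noteq> j}"

definition pgen :: "nat \<Rightarrow> nat \<times> nat \<Rightarrow> nat \<times> nat" where
  "pgen k v = (gen k (fst v), gen k (snd v))"

lemma pgen_pgen [simp]: "pgen k (pgen k v) = v"
  by (simp add: pgen_def)

lemma finite_dpairs [simp]: "finite (dpairs n)"
  by (rule finite_subset[of _ "{1..n} \<times> {1..n}"]) (auto simp: dpairs_def)

lemma card_dpairs: "card (dpairs n) = n * (n - 1)"
proof -
  have "dpairs n = (SIGMA i:{1..n}. {1..n} - {i})"
    by (auto simp: dpairs_def)
  then show ?thesis
    by simp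
qed

lemma pgen_dpairs: "k < n \<Longrightarrow> v \<in> dpairs n \<Longrightarrow> pgen k v \<in> dpairs n"
  by (auto simp: dpairs_def pgen_def gen_apply split: if_splits)

lemma bij_betw_pgen: "k < n \<Longrightarrow> bij_betw (pgen k) (dpairs n) (dpairs n)"
  by (rule bij_betwI[where g = "pgen k"]) (auto intro: pgen_dpairs)

text \<open>An entry \<open>x\<close> is moved by \<open>gen k\<close> only if \<open>k\<close> is
  \<open>x\<close> or \<open>x - 1\<close>.\<close>

lemma card_moving_gens: "card {k. k < n \<and> pgen k v \<noteq> v} \<le> 4"
proof -
  obtain i j where v: "v = (i, j)"
    by (cases v)
  have "{k. k < n \<and> pgen k v \<noteq> v} \<subseteq> {i, i - 1, j, j - 1}"
    by (auto simp: v pgen_def gen_apply split: if_splits)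
  then have "card {k. k < n \<and> pgen k v \<noteq> v} \<le> card {i, i - 1, j, j - 1}"
    by (intro card_mono) auto
  also have "\<dots> \<le> 4"
    by (auto simp: card_insert_if)
  finally show ?thesis .
qed

text \<open>Left multiplication by the inverse of one such permutation embeds all of them into the
  permutations of \<open>{3..n}\<close>.\<close>

lemma card_Sym_prescribed_pair:
  assumes v: "v \<in> dpairs n"
  shows "card {p \<in> Sym n. (p 1, p 2) = v} \<le> fact (n - 2)"
proof (cases "{p \<in> Sym n. (p 1, p 2) = v} = {}")
  case False
  then obtain s where s: "s \<in> Sym n" "(s 1, s 2) = v"
    by auto
  have n: "2 \<le> n"
    using v by (auto simp: dpairs_def)
  have "card {p \<in> Sym n. (p 1, p 2) = v} \<le> card {p. p permutes {3..n}}"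
  proof (rule card_inj_on_le)
    show "inj_on (\<lambda>p. inv s \<circ> p) {p \<in> Sym n. (p 1, p 2) = v}"
      by (rule inj_onI) (rule comp_left_cancel_Sym[OF inv_Sym[OF s(1)]])
    show "(\<lambda>p. inv s \<circ> p) ` {p \<in> Sym n. (p 1, p 2) = v} \<subseteq> {p. p permutes {3..n}}"
    proof clarify
      fix p assume p: "p \<in> Sym n" and pv: "v = (p 1, p 2)"
      have inj: "inv s (s x) = x" for x
        using bij_Sym[OF s(1)] by (simp add: bij_is_inj)
      have "(inv s \<circ> p) permutes {1..n}"
        using comp_Sym[OF inv_Sym[OF s(1)] p] by (simp add: Sym_def)
      moreover have "(inv s \<circ> p) x = x" if "x \<in> {1..n} - {3..n}" for x
      proof -
        have "x = 1 \<or> x = 2"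
          using that by auto
        then show ?thesis
          using s(2) pv inj by (metis comp_apply fst_conv snd_conv)
      qed
      ultimately show "(inv s \<circ> p) permutes {3..n}"
        by (rule permutes_superset)
    qed
    show "finite {p. p permutes {3..n}}"
      by (simp add: finite_permutations)
  qed
  also have "\<dots> = fact (n - 2)"
    using n by (subst card_permutations[of _ "n - 2"]) auto
  finally show ?thesis .
qed (simp only: card.empty)

definition pair_count :: "(nat \<Rightarrow> nat) set \<Rightarrow> nat \<times> nat \<Rightarrow> nat" where
  "pair_count C v = card {c \<in> C. (c 1, c 2) = v}"

lemma sum_pair_count:
  assumes C: "packing n C" and n: "2 \<le> n"
  shows "(\<Sum>v\<in>dpairs n. pair_count C v) = card C"
proof -
  have "(c 1, c 2) \<in> dpairs n" if "c \<in> C" for c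
  proof -
    have c: "c permutes {1..n}"
      using packing_subset_Sym[OF C] that by (auto simp: Sym_def)
    have "c 1 \<in> {1..n}" "c 2 \<in> {1..n}"
      unfolding permutes_in_image[OF c] using n by auto
    moreover have "c 1 \<noteq> c 2"
      using inj_eq[OF permutes_inj[OF c], of 1 2] by simp
    ultimately show ?thesis
      by (simp add: dpairs_def)
  qed
  then have "card C = card (\<Union>v\<in>dpairs n. {c \<in> C. (c 1, c 2) = v})"
    by (intro arg_cong[of _ _ card]) auto
  also have "\<dots> = (\<Sum>v\<in>dpairs n. pair_count C v)"
    unfolding pair_count_def using packing_finite[OF C] by (intro card_UN_disjoint) auto
  finally show ?thesis ..
qed

text \<open>If \<open>c\<close> sends (1, 2) to \<open>pgen k v\<close>, then
  \<open>gen k \<circ> c\<close> sends it to \<open>v\<close>. These products are distinct because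
  the balls are disjoint.\<close>

lemma sum_pair_count_pgen_le:
  assumes C: "packing n C" and v: "v \<in> dpairs n"
  shows "(\<Sum>k<n. pair_count C (pgen k v)) \<le> fact (n - 2)"
proof -
  let ?S = "SIGMA k:{..<n}. {c \<in> C. (c 1, c 2) = pgen k v}"
  have "(\<Sum>k<n. pair_count C (pgen k v)) = card ?S"
    unfolding pair_count_def using packing_finite[OF C] by simp
  also have "\<dots> = card ((\<lambda>(k, c). gen k \<circ> c) ` ?S)"
    by (rule card_image[symmetric], rule inj_on_subset[OF packing_ball_inj[OF C]]) auto
  also have "\<dots> \<le> card {p \<in> Sym n. (p 1, p 2) = v}"
  proof (rule card_mono)
    show "(\<lambda>(k, c). gen k \<circ> c) ` ?S \<subseteq> {p \<in> Sym n. (p 1, p 2) = v}"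
      using packing_subset_Sym[OF C] by (auto simp: pgen_def intro!: comp_Sym gen_Sym)
  qed simp
  also have "\<dots> \<le> fact (n - 2)"
    by (rule card_Sym_prescribed_pair[OF v])
  finally show ?thesis .
qed

text \<open>Each positive part, taken four times, is paid for by the negative parts at the
  neighbours. A negative part is charged at most four times in total, since at most four generators
  move a pair.\<close>

lemma sum_excess_nonpos:
  fixes z :: "nat \<times> nat \<Rightarrow> int"
  assumes n: "9 \<le> n" and z: "\<And>v. v \<in> dpairs n \<Longrightarrow> (\<Sum>k<n. z (pgen k v)) \<le> 1"
  shows "(\<Sum>v\<in>dpairs n. z v) \<le> 0"
proof -
  define zp zn where "zp v = max (z v) 0" and "zn v = max (- z v) 0" for v
  define mv where "mv v = {k. k < n \<and> pgen k v \<noteq> v}" for v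
  have nonneg: "0 \<le> zp v" "0 \<le> zn v" and split: "z v = zp v - zn v" for v
    by (auto simp: zp_def zn_def)
  have mv4: "card (mv v) \<le> 4" and fin: "finite (mv v)" for v
    using card_moving_gens[of n v] by (auto simp: mv_def)
  \<comment> \<open>At least \<open>n - 4 \<ge> 5\<close> indices fix \<open>v\<close> and
    contribute \<open>z v\<close> each. If \<open>z v\<close> is positive, the upper bound 1 is at
    most \<open>z v\<close> and uses up one of five copies.\<close>
  have local: "4 * zp v \<le> (\<Sum>k\<in>mv v. zn (pgen k v))" if v: "v \<in> dpairs n" for v
  proof (cases "z v \<le> 0")
    case True
    then show ?thesis
      using nonneg by (simp add: zp_def sum_nonneg)
  next
    case False
    then have zv: "zp v = z v" "1 \<le> z v"
      by (auto simp: zp_def)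
    have sub: "mv v \<subseteq> {..<n}"
      by (auto simp: mv_def)
    have "(\<Sum>k\<in>mv v. - zn (pgen k v)) \<le> (\<Sum>k\<in>mv v. z (pgen k v))"
      by (rule sum_mono) (auto simp: zn_def)
    moreover have "(\<Sum>k\<in>{..<n} - mv v. z (pgen k v)) = (\<Sum>k\<in>{..<n} - mv v. z v)"
      by (rule sum.cong) (auto simp: mv_def)
    moreover have "(\<Sum>k\<in>{..<n} - mv v. z v) = int (n - card (mv v)) * z v"
      using sub by (simp add: card_Diff_subset[OF fin])
    moreover have "5 * z v \<le> int (n - card (mv v)) * z v"
      using zv n mv4[of v] by (intro mult_right_mono) auto
    moreover have "(\<Sum>k<n. z (pgen k v)) =
        (\<Sum>k\<in>{..<n} - mv v. z (pgen k v)) + (\<Sum>k\<in>mv v. z (pgen k v))"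
      by (rule sum.subset_diff[OF sub]) simp
    ultimately show ?thesis
      using z[OF v] zv unfolding sum_negf by linarith
  qed
  have "4 * (\<Sum>v\<in>dpairs n. zp v) \<le> (\<Sum>v\<in>dpairs n. \<Sum>k\<in>mv v. zn (pgen k v))"
    unfolding sum_distrib_left by (rule sum_mono) (rule local)
  also have "\<dots> = (\<Sum>v\<in>dpairs n. \<Sum>k<n. if k \<in> mv v then zn (pgen k v) else 0)"
    by (intro sum.cong refl sum.mono_neutral_cong_left) (auto simp: mv_def)
  \<comment> \<open>The index \<open>k\<close> moves \<open>v\<close> iff it moves
    \<open>pgen k v\<close>; in this form the involution \<open>pgen k\<close> can be used to
    reindex the sum over \<open>v\<close>.\<close>
  also have "\<dots> = (\<Sum>k<n. \<Sum>v\<in>dpairs n. if k \<in> mv (pgen k v) then zn (pgen k v) else 0)"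
    by (subst sum.swap) (intro sum.cong refl, auto simp: mv_def)
  also have "\<dots> = (\<Sum>k<n. \<Sum>v\<in>dpairs n. if k \<in> mv v then zn v else 0)"
    by (intro sum.cong refl sum.reindex_bij_betw[OF bij_betw_pgen]) auto
  also have "\<dots> = (\<Sum>v\<in>dpairs n. \<Sum>k<n. if k \<in> mv v then zn v else 0)"
    by (rule sum.swap)
  also have "\<dots> = (\<Sum>v\<in>dpairs n. int (card (mv v)) * zn v)"
  proof (rule sum.cong[OF refl])
    fix v
    have "{..<n} \<inter> mv v = mv v"
      by (auto simp: mv_def)
    then show "(\<Sum>k<n. if k \<in> mv v then zn v else 0) = int (card (mv v)) * zn v"
      by (simp add: sum.inter_restrict[symmetric])
  qed
  also have "\<dots> \<le> (\<Sum>v\<in>dpairs n. 4 * zn v)"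
    using mv4 nonneg by (intro sum_mono mult_right_mono) auto
  finally have "(\<Sum>v\<in>dpairs n. zp v) \<le> (\<Sum>v\<in>dpairs n. zn v)"
    by (simp add: sum_distrib_left[symmetric])
  then show ?thesis
    by (simp add: split sum_subtractf)
qed

text \<open>With \<open>fact (n - 2) = n * q + 1\<close>, nonpositive total excess over the
  \<open>n * (n - 1)\<close> pairs bounds the code by \<open>(n - 1) * (n * q)\<close>, which is
  \<open>(n - 1) * (fact (n - 2) - 1)\<close>.\<close>

lemma P_3_le_fact_diff:
  assumes n: "9 \<le> n" and cong: "fact (n - 2) mod n = 1"
  shows "P n 3 \<le> fact (n - 1) - (n - 1)"
proof (rule P_3_le)
  fix C assume C: "packing n C"
  define q where "q = fact (n - 2) div n"
  have q: "fact (n - 2) = n * q + 1"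
    using cong div_mult_mod_eq[of "fact (n - 2)" n] by (simp add: q_def mult.commute)
  define z where "z v = int (pair_count C v) - int q" for v
  have "(\<Sum>k<n. z (pgen k v)) \<le> 1" if "v \<in> dpairs n" for v
  proof -
    have "int (\<Sum>k<n. pair_count C (pgen k v)) \<le> int (n * q + 1)"
      unfolding of_nat_le_iff using sum_pair_count_pgen_le[OF C that] q by simp
    then show ?thesis
      by (simp add: z_def sum_subtractf)
  qed
  from sum_excess_nonpos[OF n this] have "int (\<Sum>v\<in>dpairs n. pair_count C v) \<le> int (n * (n - 1) * q)"
    by (simp add: z_def sum_subtractf card_dpairs)
  then have "card C \<le> n * (n - 1) * q"
    using sum_pair_count[OF C] n by (simp only: of_nat_le_iff)
  also have "\<dots> = (n - 1) * (n * q)"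
    by simp
  also have "\<dots> = fact (n - 1) - (n - 1)"
  proof -
    have "fact (n - 1) = (n - 1) * (fact (n - 2) :: nat)"
      using n fact_reduce[of "n - 1", where ?'a = nat] by (simp add: numeral_2_eq_2)
    then show ?thesis
      by (simp add: q algebra_simps)
  qed
  finally show "card C \<le> fact (n - 1) - (n - 1)" .
qed

section \<open>Local obstructions\<close>

text \<open>Balls arise by left multiplication, which commutes with right multiplication by
  \<open>g\<close>.\<close>

lemma right_translate_packing:
  assumes C: "packing n C" and g: "g \<in> Sym n"
  shows "packing n {p. p \<circ> g \<in> C}"
proof -
  have "p \<in> Sym n" if "p \<circ> g \<in> C" for p
  proof -
    have "p \<circ> g \<circ> inv g \<in> Sym n"
      using that packing_subset_Sym[OF C] g by (blast intro: comp_Sym inv_Sym)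
    moreover have "g \<circ> inv g = id"
      using bij_Sym[OF g] by (simp add: surj_iff[symmetric] bij_is_surj)
    ultimately show ?thesis
      by (simp add: comp_assoc)
  qed
  moreover have "p = q" if "p \<circ> g \<in> C" "q \<circ> g \<in> C" "k < n" "l < n" "gen k \<circ> p = gen l \<circ> q" for p q k l
  proof -
    have "gen k \<circ> (p \<circ> g) = gen l \<circ> (q \<circ> g)"
      using that(5) by (simp add: comp_assoc[symmetric])
    then show ?thesis
      using packingD[OF C that(1-4)] comp_right_cancel_Sym[OF g] by blast
  qed
  ultimately show ?thesis
    by (auto simp: packing_def)
qed

text \<open>Double counting of the pairs \<open>(r, g)\<close> with \<open>r \<circ> g\<close>
  uncovered: every \<open>g\<close> has at least \<open>m\<close> partners, and every
  \<open>r\<close> at most as many as there are uncovered permutations.\<close>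

lemma uncovered_average:
  assumes R: "R \<subseteq> Sym n" and m: "\<And>K. packing n K \<Longrightarrow> m \<le> card (R \<inter> uncovered n K)"
    and C: "packing n C"
  shows "m * fact n \<le> card R * card (uncovered n C)"
proof -
  let ?U = "uncovered n C"
  have fin: "finite R"
    by (rule finite_subset[OF R finite_Sym])
  have "m * fact n = (\<Sum>g\<in>Sym n. m)"
    by (simp add: card_Sym)
  also have "\<dots> \<le> (\<Sum>g\<in>Sym n. card {r \<in> R. r \<circ> g \<in> ?U})"
  proof (rule sum_mono)
    fix g assume g: "g \<in> Sym n"
    have "R \<inter> uncovered n {p. p \<circ> g \<in> C} \<subseteq> {r \<in> R. r \<circ> g \<in> ?U}"
      using R g by (auto simp: uncovered_def comp_assoc intro!: comp_Sym)
    then have "card (R \<inter> uncovered n {p. p \<circ> g \<in> C}) \<le> card {r \<in> R. r \<circ> g \<in> ?U}"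
      using fin by (intro card_mono) auto
    then show "m \<le> card {r \<in> R. r \<circ> g \<in> ?U}"
      using m[OF right_translate_packing[OF C g]] by simp
  qed
  also have "\<dots> = (\<Sum>r\<in>R. card {g \<in> Sym n. r \<circ> g \<in> ?U})"
    by (rule sum_multicount_gen[OF finite_Sym fin]) simp
  also have "\<dots> \<le> (\<Sum>r\<in>R. card ?U)"
  proof (rule sum_mono)
    fix r assume r: "r \<in> R"
    show "card {g \<in> Sym n. r \<circ> g \<in> ?U} \<le> card ?U"
    proof (rule card_inj_on_le[where f = "\<lambda>g. r \<circ> g"])
      show "inj_on (\<lambda>g. r \<circ> g) {g \<in> Sym n. r \<circ> g \<in> ?U}"
        using comp_left_cancel_Sym R r by (blast intro: inj_onI)
    qed (auto simp: uncovered_def)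
  qed
  finally show ?thesis
    by simp
qed

section \<open>Permutations as words in one-line notation, and conflicts between words\<close>

definition perm_of_list :: "nat list \<Rightarrow> nat \<Rightarrow> nat" where
  "perm_of_list v i = (if i \<in> {1..length v} then v ! (i - 1) else i)"

lemma perm_of_list_Sym:
  assumes "distinct v" "set v \<subseteq> {1..length v}"
  shows "perm_of_list v \<in> Sym (length v)"
proof -
  have inj: "inj_on (perm_of_list v) {1..length v}"
  proof (rule inj_onI)
    fix i j assume *: "i \<in> {1..length v}" "j \<in> {1..length v}" "perm_of_list v i = perm_of_list v j"
    then have "v ! (i - 1) = v ! (j - 1)" "i - 1 < length v" "j - 1 < length v"
      by (auto simp: perm_of_list_def)
    then have "i - 1 = j - 1"
      using assms(1) by (simp add: nth_eq_iff_index_eq)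
    then show "i = j"
      using * by auto
  qed
  have "perm_of_list v ` {1..length v} \<subseteq> {1..length v}"
  proof clarify
    fix i assume "i \<in> {1..length v}"
    then have "perm_of_list v i = v ! (i - 1)" "i - 1 < length v"
      by (auto simp: perm_of_list_def)
    then show "perm_of_list v i \<in> {1..length v}"
      using assms(2) nth_mem by (metis subsetD)
  qed
  then have "bij_betw (perm_of_list v) {1..length v} {1..length v}"
    using inj endo_inj_surj[of "{1..length v}" "perm_of_list v"] by (simp add: bij_betw_def)
  then have "perm_of_list v permutes {1..length v}"
    by (rule bij_imp_permutes) (auto simp: perm_of_list_def)
  then show ?thesis
    by (simp add: Sym_def)
qed

lemma gen_comp_perm_of_list:
  assumes "k < length v"
  shows "gen k \<circ> perm_of_list v = perm_of_list (map (gen k) v)"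
proof
  fix i
  show "(gen k \<circ> perm_of_list v) i = perm_of_list (map (gen k) v) i"
  proof (cases "i \<in> {1..length v}")
    case True
    then have "i - 1 < length v"
      by auto
    with True show ?thesis
      by (simp add: perm_of_list_def)
  next
    case False
    \<comment> \<open>For \<open>k > 0\<close> both \<open>k\<close> and \<open>Suc k\<close> lie in
      \<open>{1..length v}\<close>, since \<open>k < length v\<close>.\<close>
    then have "gen k i = i"
      using assms by (auto simp: gen_apply)
    with False show ?thesis
      by (simp only: perm_of_list_def comp_apply length_map if_False)
  qed
qed

lemma perm_of_list_inj:
  assumes "length v = length w" "perm_of_list v = perm_of_list w"
  shows "v = w"
proof (rule nth_equalityI)
  fix i assume "i < length v"
  then show "v ! i = w ! i"
    using assms(1) fun_cong[OF assms(2), of "Suc i"] by (simp add: perm_of_list_def)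
qed (rule assms(1))

fun move :: "nat \<times> nat \<Rightarrow> nat list \<Rightarrow> nat list" where
  "move (a, b) v = map (\<lambda>x. gen a (gen b x)) v"

lemma length_move [simp]: "length (move u v) = length v"
  by (cases u) simp

text \<open>The word \<open>move (a, b) v\<close> and \<open>v\<close> have a common neighbour,
  reached by \<open>gen a\<close> from the former and by \<open>gen b\<close> from the
  latter.\<close>

lemma packing_move_conflict:
  assumes K: "packing (length v) K" and ab: "a < length v" "b < length v" "a \<noteq> b"
    and v: "perm_of_list v \<in> K"
  shows "perm_of_list (move (a, b) v) \<notin> K"
proof
  assume mv: "perm_of_list (move (a, b) v) \<in> K"
  have eq: "perm_of_list (move (a, b) v) = gen a \<circ> (gen b \<circ> perm_of_list v)"
    using ab by (simp add: gen_comp_perm_of_list) (simp add: comp_def)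
  then have "gen a \<circ> perm_of_list (move (a, b) v) = gen b \<circ> perm_of_list v"
    by (simp add: comp_assoc[symmetric])
  then have "gen a \<circ> perm_of_list v = gen b \<circ> perm_of_list v"
    using packingD[OF K mv v ab(1,2)] by simp
  then have "gen a = gen b"
    using comp_right_cancel_Sym packing_subset_Sym[OF K] v by blast
  then show False
    using ab(3) inj_gen by (auto dest: injD)
qed

text \<open>
  An entry \<open>(x, us)\<close> of the table \<open>T\<close> stands for the words of the coset \<open>x W\<close>, each of which is at
  distance at most two from its images under the elements of \<open>us\<close>; a pair \<open>(a, b)\<close> encodes
  \<open>s\<^sub>a s\<^sub>b\<close> with \<open>s\<^sub>0\<close> the identity.
\<close>

definition conflicts_avoided ::
  "nat list list \<Rightarrow> ((nat \<times> nat) \<times> (nat \<times> nat) list) list \<Rightarrow> (nat list \<Rightarrow> bool) \<Rightarrow> bool" where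
  "conflicts_avoided W T c \<longleftrightarrow>
     list_all (\<lambda>(x, us). list_all (\<lambda>u. list_all
       (\<lambda>w. \<not> c (move x w) \<or> \<not> c (move u (move x w))) W) us) T"

lemma packing_conflicts_avoided:
  assumes K: "packing n K" and W: "list_all (\<lambda>w. length w = n) W"
    and T: "list_all (\<lambda>(x, us). list_all (\<lambda>(a, b). a < n \<and> b < n \<and> a \<noteq> b) us) T"
  shows "conflicts_avoided W T (\<lambda>v. perm_of_list v \<in> K)"
proof -
  have "perm_of_list (move x w) \<notin> K \<or> perm_of_list (move u (move x w)) \<notin> K"
    if "(x, us) \<in> set T" "u \<in> set us" "w \<in> set W" for x us u w
  proof -
    obtain a b where u: "u = (a, b)"
      by (cases u)
    have "length (move x w) = n" "a < n" "b < n" "a \<noteq> b"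
      using that W T by (auto simp: u list_all_iff)
    then show ?thesis
      using packing_move_conflict[of "move x w" K a b] K by (auto simp: u simp del: move.simps)
  qed
  then show ?thesis
    unfolding conflicts_avoided_def list_all_iff by blast
qed

lemma uncovered_perm_of_list_iff:
  assumes "distinct v" "set v \<subseteq> {1..length v}"
  shows "perm_of_list v \<in> uncovered (length v) K \<longleftrightarrow>
    \<not> (\<exists>k<length v. perm_of_list (map (gen k) v) \<in> K)"
  using perm_of_list_Sym[OF assms] unfolding uncovered_def by (simp add: gen_comp_perm_of_list)

section \<open>Neighbourhoods of Young subgroups in degrees 6 and 7\<close>

definition young33 :: "nat list list" where
  "young33 = [a @ b. a \<leftarrow> [[1,2,3],[1,3,2],[2,1,3],[2,3,1],[3,1,2],[3,2,1]],
     b \<leftarrow> [[4,5,6],[4,6,5],[5,4,6],[5,6,4],[6,4,5],[6,5,4]]]"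

text \<open>Only \<open>gen 0\<close> and \<open>gen 3\<close> are listed: the generators 1, 2, 4, 5
  lie in the Young subgroup and map it to itself.\<close>

definition region33 :: "nat list list" where
  "region33 = [map (gen k) w. k \<leftarrow> [0,3], w \<leftarrow> young33]"

text \<open>The four cosets contain every word whose ball meets the region: \<open>gen 1\<close> and
  \<open>gen 5\<close> commute with \<open>gen 3\<close>, so beyond the region only
  \<open>gen 2\<close> and \<open>gen 4\<close> lead to new cosets.\<close>

definition conflicts33 :: "((nat \<times> nat) \<times> (nat \<times> nat) list) list" where
  "conflicts33 =
    [((0,0), [(0,1), (0,2), (0,3), (0,4), (0,5), (1,2), (1,3), (1,4), (1,5), (2,4), (2,5),
       (3,2), (3,4), (3,5), (4,5)]),
     ((0,3), [(0,1), (0,5), (3,2), (3,4)]),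
     ((2,3), [(0,3), (0,5)]),
     ((4,3), [(0,1)])]"

definition young322 :: "nat list list" where
  "young322 = [a @ b @ d. a \<leftarrow> [[1,2,3],[1,3,2],[2,1,3],[2,3,1],[3,1,2],[3,2,1]],
     b \<leftarrow> [[4,5],[5,4]], d \<leftarrow> [[6,7],[7,6]]]"

definition region322 :: "nat list list" where
  "region322 = [map (gen k) w. k \<leftarrow> [0,3,5], w \<leftarrow> young322]"

text \<open>Again these cosets contain every possible covering word of the region;
  \<open>(5,3)\<close> also represents \<open>(3,5)\<close>, as the two generators commute.\<close>

definition conflicts322 :: "((nat \<times> nat) \<times> (nat \<times> nat) list) list" where
  "conflicts322 =
    [((0,0), [(0,1), (0,2), (0,3), (0,4), (0,5), (0,6), (1,2), (1,3), (1,4), (1,5), (1,6),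
       (2,4), (2,5), (2,6), (3,2), (3,4), (3,6), (4,6), (5,4), (5,6)]),
     ((0,3), [(0,1), (0,5), (0,6), (1,5), (1,6), (3,4), (3,5), (5,6)]),
     ((0,5), [(0,1), (0,2), (0,3), (1,2), (1,3), (3,2), (5,4), (5,6)]),
     ((2,3), [(0,3), (0,6), (3,6)]),
     ((4,3), [(0,1), (0,6), (1,6)]),
     ((5,3), [(0,1)]),
     ((4,5), [(0,1), (0,2), (0,5), (1,2), (1,5)]),
     ((6,5), [(0,1), (0,2), (0,5), (1,2), (1,5), (2,5)])]"

text \<open>
  The predicate \<open>e\<close> describes the entries of one exceptional word of the region. A free predicate
  instead of equations on a list keeps its instances atomic for the propositional solver.
\<close>

lemma region33_not_covered_but_one:
  fixes c :: "nat list \<Rightarrow> bool" and e :: "nat \<Rightarrow> nat \<Rightarrow> bool"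
  assumes cov: "list_all (\<lambda>v. list_all (\<lambda>(i, a).
        list_ex (\<lambda>k. c (map (gen k) v)) [0,1,2,3,4,5] \<or> e i a) (zip [0,1,2,3,4,5] v)) region33"
    and conf: "conflicts_avoided young33 conflicts33 c"
    and excl: "list_all (\<lambda>i. list_all (\<lambda>a. list_all (\<lambda>b. a = b \<or> \<not> e i a \<or> \<not> e i b)
        [1,2,3,4,5,6]) [1,2,3,4,5,6]) [0,1,2,3,4,5]"
  shows False
proof -
  \<comment> \<open>Unfolding leaves propositional formulas in atoms \<open>c\<close> and
    \<open>e\<close> at explicit arguments. Folding \<open>Suc (Suc 0)\<close> back to 2 gives equal
    words the same normal form, hence the same atom.\<close>
  note [simp] = young33_def region33_def conflicts33_def conflicts_avoided_def gen_apply
    numeral_2_eq_2[symmetric]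
  show False
    using cov[simplified] conf[simplified] excl[simplified] by sat
qed

text \<open>A finite unsatisfiability check: one covering clause for each of the 72 words against
  the pairwise exclusions of the table.\<close>

lemma region322_not_covered:
  fixes c :: "nat list \<Rightarrow> bool"
  assumes cov: "list_all (\<lambda>v. list_ex (\<lambda>k. c (map (gen k) v)) [0,1,2,3,4,5,6]) region322"
    and conf: "conflicts_avoided young322 conflicts322 c"
  shows False
proof -
  note [simp] = young322_def region322_def conflicts322_def conflicts_avoided_def gen_apply
    numeral_2_eq_2[symmetric]
  show False
    using cov[simplified] conf[simplified] by sat
qed

lemma region33_lists:
  "list_all (\<lambda>v. length v = 6 \<and> distinct v \<and> list_all (\<lambda>x. 1 \<le> x \<and> x \<le> 6) v) region33"
  by (simp add: region33_def young33_def gen_apply)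

lemma region322_lists:
  "list_all (\<lambda>v. length v = 7 \<and> distinct v \<and> list_all (\<lambda>x. 1 \<le> x \<and> x \<le> 7) v) region322"
  by (simp add: region322_def young322_def gen_apply)

lemma two_uncovered_in_region33:
  assumes K: "packing 6 K"
  shows "2 \<le> card (perm_of_list ` set region33 \<inter> uncovered 6 K)"
proof (rule ccontr)
  assume "\<not> ?thesis"
  then have card: "card (perm_of_list ` set region33 \<inter> uncovered 6 K) \<le> Suc 0"
    by simp
  define c where "c v \<longleftrightarrow> perm_of_list v \<in> K" for v
  have lists: "length v = 6" "distinct v" "set v \<subseteq> {1..length v}" if "v \<in> set region33" for v
    using region33_lists that by (auto simp: list_all_iff)
  \<comment> \<open>With no uncovered word in the region, any list serves as
    \<open>r\<close>.\<close>
  obtain r where r: "\<And>v. v \<in> set region33 \<Longrightarrow> perm_of_list v \<in> uncovered 6 K \<Longrightarrow> v = r"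
  proof (cases "\<exists>r\<in>set region33. perm_of_list r \<in> uncovered 6 K")
    case True
    then obtain r where r: "r \<in> set region33" "perm_of_list r \<in> uncovered 6 K"
      by blast
    show thesis
    proof (rule that)
      fix v assume v: "v \<in> set region33" "perm_of_list v \<in> uncovered 6 K"
      then have "perm_of_list v = perm_of_list r"
        using r card by (auto simp: card_le_Suc0_iff_eq)
      then show "v = r"
        using lists(1) v r by (intro perm_of_list_inj) auto
    qed
  qed (use that in blast)
  have cov: "(\<exists>k<6. c (map (gen k) v)) \<or> v = r" if "v \<in> set region33" for v
    using r[OF that] uncovered_perm_of_list_iff[OF lists(2,3)[OF that], of K] lists(1)[OF that]
    by (auto simp: c_def)
  have lt6: "set [0,1,2,3,4,5] = {..<6::nat}"
    by auto
  show False
  proof (rule region33_not_covered_but_one)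
    \<comment> \<open>The predicate \<open>e i a\<close> becomes \<open>r ! i = a\<close>. An
      uncovered word equals \<open>r\<close> and so satisfies it at every position, while each
      position admits a single value.\<close>
    show "list_all (\<lambda>v. list_all (\<lambda>(i, a). list_ex (\<lambda>k. c (map (gen k) v)) [0,1,2,3,4,5] \<or> r ! i = a)
        (zip [0,1,2,3,4,5] v)) region33"
      unfolding list_all_iff list_ex_iff
    proof (intro ballI, clarify)
      fix v i a assume v: "v \<in> set region33" and ia: "(i, a) \<in> set (zip [0,1,2,3,4,5] v)"
        and ne: "r ! i \<noteq> a"
      have "a = v ! i"
        using ia lists(1)[OF v] by (auto simp: set_zip less_Suc_eq numeral_nat)
      then have "v \<noteq> r"
        using ne by auto
      then obtain k where "k < 6" "c (map (gen k) v)"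
        using cov[OF v] by auto
      then show "\<exists>k\<in>set [0,1,2,3,4,5]. c (map (gen k) v)"
        unfolding lt6 by blast
    qed
    show "conflicts_avoided young33 conflicts33 c"
      unfolding c_def
      by (rule packing_conflicts_avoided[OF K]) (simp_all add: young33_def conflicts33_def)
  qed (auto simp: list_all_iff)
qed

lemma uncovered_in_region322:
  assumes K: "packing 7 K"
  shows "1 \<le> card (perm_of_list ` set region322 \<inter> uncovered 7 K)"
proof (rule ccontr)
  assume "\<not> ?thesis"
  then have none: "perm_of_list ` set region322 \<inter> uncovered 7 K = {}"
    by (simp add: not_le)
  define c where "c v \<longleftrightarrow> perm_of_list v \<in> K" for v
  have lists: "length v = 7" "distinct v" "set v \<subseteq> {1..length v}" if "v \<in> set region322" for v
    using region322_lists that by (auto simp: list_all_iff)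
  have cov: "\<exists>k<7. c (map (gen k) v)" if "v \<in> set region322" for v
    using none that uncovered_perm_of_list_iff[OF lists(2,3)[OF that], of K] lists(1)[OF that]
    by (auto simp: c_def)
  have lt7: "set [0,1,2,3,4,5,6] = {..<7::nat}"
    by auto
  show False
  proof (rule region322_not_covered)
    show "list_all (\<lambda>v. list_ex (\<lambda>k. c (map (gen k) v)) [0,1,2,3,4,5,6]) region322"
      unfolding list_all_iff list_ex_iff
    proof
      fix v assume v: "v \<in> set region322"
      then obtain k where "k < 7" "c (map (gen k) v)"
        using cov[OF v] by auto
      then show "\<exists>k\<in>set [0,1,2,3,4,5,6]. c (map (gen k) v)"
        unfolding lt7 by blast
    qed
    show "conflicts_avoided young322 conflicts322 c"
      unfolding c_def
      by (rule packing_conflicts_avoided[OF K]) (simp_all add: young322_def conflicts322_def)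
  qed
qed

text \<open>The list length may replace the size of the region because it is an upper bound for
  it.\<close>

lemma uncovered_average_lists:
  assumes "list_all (\<lambda>v. length v = n \<and> distinct v \<and> list_all (\<lambda>x. 1 \<le> x \<and> x \<le> n) v) vs"
    and m: "\<And>K. packing n K \<Longrightarrow> m \<le> card (perm_of_list ` set vs \<inter> uncovered n K)"
    and C: "packing n C"
  shows "m * fact n \<le> length vs * card (uncovered n C)"
proof -
  have "perm_of_list ` set vs \<subseteq> Sym n"
    using assms(1) perm_of_list_Sym by (fastforce simp: list_all_iff)
  then have "m * fact n \<le> card (perm_of_list ` set vs) * card (uncovered n C)"
    by (rule uncovered_average[OF _ m C])
  also have "\<dots> \<le> length vs * card (uncovered n C)"
    using card_image_le[of "set vs" perm_of_list] card_length[of vs] by (intro mult_right_mono) auto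
  finally show ?thesis .
qed

section \<open>The numerical bounds\<close>

lemma P_6_3_le: "P 6 3 \<le> 116"
proof (rule P_3_le)
  fix C assume C: "packing 6 C"
  have "length region33 = 72"
    by (simp add: region33_def young33_def)
  then have "2 * fact 6 \<le> 72 * card (uncovered 6 C)"
    using uncovered_average_lists[OF region33_lists two_uncovered_in_region33 C] by simp
  \<comment> \<open>At least 2 * 720 / 72 = 20 permutations are uncovered, so six times the size of
    \<open>C\<close> is at most 700.\<close>
  then show "card C \<le> 116"
    using card_packing[OF C] by (simp add: fact_numeral)
qed

lemma P_7_3_le: "P 7 3 \<le> 716"
proof (rule P_3_le)
  fix C assume C: "packing 7 C"
  have "length region322 = 72"
    by (simp add: region322_def young322_def)
  then have "1 * fact 7 \<le> 72 * card (uncovered 7 C)"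
    using uncovered_average_lists[OF region322_lists uncovered_in_region322 C] by simp
  \<comment> \<open>At least 5040 / 72 = 70 permutations are uncovered, which gives even 710 as a
    bound.\<close>
  then show "card C \<le> 716"
    using card_packing[OF C] by (simp add: fact_numeral)
qed

theorem theorem3p5:
  shows "P 6 3 \<le> 116 \<and> P 7 3 \<le> 716 \<and> P 11 3 \<le> fact 10 - 10
         \<and> P 13 3 \<le> fact 12 - 12 \<and> P 17 3 \<le> fact 16 - 5"
proof (intro conjI P_6_3_le P_7_3_le)
  show "P 11 3 \<le> fact 10 - 10"
    using P_3_le_fact_diff[of 11] by (simp add: fact_numeral)
  show "P 13 3 \<le> fact 12 - 12"
    using P_3_le_fact_diff[of 13] by (simp add: fact_numeral)
  \<comment> \<open>The lemma yields the stronger bound \<open>fact 16 - 16\<close>.\<close>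
  show "P 17 3 \<le> fact 16 - 5"
    using P_3_le_fact_diff[of 17] by (simp add: fact_numeral)
qed

end
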